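(* Let $\Delta$ be a twin building of type $(W,S)$ and let $J\subseteq S$ be nonempty. An automorphism $\theta$ of $\Delta$ maps all $S\setminus J$-residues to opposite residues if and only if it maps all chambers to opposite chambers. Moreover, if $\theta$ maps all chambers to opposite chambers, then $\theta$ is type preserving and maps all residues to opposite residues.
   Context: $(W,S)$ is a Coxeter system with $S$ finite and $W$ irreducible; $W_J$ is the subgroup generated by $J$. A twin building of type $(W,S)$ consists of two buildings $\Delta^+,\Delta^-$ of type $(W,S)$ (with $W$-distance $\delta$) and a codistance $\delta^*$ on pairs of chambers in different halves satisfying the usual axioms (Tw1) $\delta^*(D,C)=\delta^*(C,D)^{-1}$; (Tw2) if $\delta(D,E)=s\in S$ and $\ell(sw)=\ell(w)-1$ with $w=\delta^*(C,D)$ then $\delta^*(C,E)=sw$; (Tw3) for each $s\in S$ there is $E$ with $\delta(D,E)=s$ and $\delta^*(C,E)=sw$. A $J$-residue of $\Delta^\epsilon$ is a set $\{D\in\Delta^\epsilon:\delta(C,D)\in W_J\}$. Chambers in different halves are opposite if $\delta^*(C,D)=1$; residues $P,Q$ in different halves are opposite if every chamber of $P$ is opposite some chamber of $Q$. An automorphism is a bijection of the chamber set preserving adjacency and opposition; it induces an automorphism $\sigma$ of the Coxeter graph with $s$-adjacent chambers mapped to $\sigma(s)$-adjacent chambers, and it is type preserving if $\sigma$ is the identity. *)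

theory Defs
  imports "HOL-Algebra.Algebra"
begin

section \<open>Coxeter systems\<close>

definition word_prod :: "('w, 'm) monoid_scheme \<Rightarrow> 'w list \<Rightarrow> 'w" where
  "word_prod W ws = foldr (\<otimes>\<^bsub>W\<^esub>) ws \<one>\<^bsub>W\<^esub>"

definition cox_length :: "('w, 'm) monoid_scheme \<Rightarrow> 'w set \<Rightarrow> 'w \<Rightarrow> nat" where
  "cox_length W S w = (LEAST n. \<exists>ws. set ws \<subseteq> S \<and> length ws = n \<and> word_prod W ws = w)"

text \<open>The order \<open>m(s,t)\<close> of \<open>st\<close>; \<^const>\<open>group.ord\<close> is \<open>0\<close> on elements of infinite order,
  so that \<open>0\<close> encodes \<open>\<infinity>\<close>, and the corresponding relator below is the empty word.\<close>

definition cox_m :: "('w, 'm) monoid_scheme \<Rightarrow> 'w \<Rightarrow> 'w \<Rightarrow> nat" where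
  "cox_m W s t = group.ord W (s \<otimes>\<^bsub>W\<^esub> t)"

text \<open>The congruence on the free monoid over \<open>S\<close> generated by the Coxeter relations
  \<open>(st)\<^bsup>m(s,t)\<^esup> = 1\<close>. For \<open>s = t\<close> the relator is \<open>s s\<close>, so the quotient monoid is the group with
  that presentation.\<close>

inductive cox_equiv :: "('w, 'm) monoid_scheme \<Rightarrow> 'w set \<Rightarrow> 'w list \<Rightarrow> 'w list \<Rightarrow> bool"
  for W S where
  relator: "s \<in> S \<Longrightarrow> t \<in> S \<Longrightarrow> set us \<subseteq> S \<Longrightarrow> set vs \<subseteq> S \<Longrightarrow>
    cox_equiv W S (us @ concat (replicate (cox_m W s t) [s, t]) @ vs) (us @ vs)"
| refl: "set us \<subseteq> S \<Longrightarrow> cox_equiv W S us us"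
| sym: "cox_equiv W S us vs \<Longrightarrow> cox_equiv W S vs us"
| trans: "cox_equiv W S us vs \<Longrightarrow> cox_equiv W S vs ws \<Longrightarrow> cox_equiv W S us ws"

locale coxeter_system = group W for W :: "('w, 'm) monoid_scheme" (structure) +
  fixes S :: "'w set"
  assumes gens_closed: "S \<subseteq> carrier W"
    and gens_generate: "generate W S = carrier W"
    and gens_nontrivial: "s \<in> S \<Longrightarrow> s \<noteq> \<one>"
    and gens_involution: "s \<in> S \<Longrightarrow> s \<otimes> s = \<one>"
    and presentation: "set us \<subseteq> S \<Longrightarrow> set vs \<subseteq> S \<Longrightarrow> word_prod W us = word_prod W vs \<Longrightarrow>
      cox_equiv W S us vs"

text \<open>Edges of the Coxeter graph: \<open>m(s,t) \<ge> 3\<close> or \<open>m(s,t) = \<infinity>\<close>.\<close>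

definition cox_graph :: "('w, 'm) monoid_scheme \<Rightarrow> 'w set \<Rightarrow> ('w \<times> 'w) set" where
  "cox_graph W S = {(s, t). s \<in> S \<and> t \<in> S \<and> (cox_m W s t \<ge> 3 \<or> cox_m W s t = 0)}"

definition cox_irreducible :: "('w, 'm) monoid_scheme \<Rightarrow> 'w set \<Rightarrow> bool" where
  "cox_irreducible W S \<longleftrightarrow> S \<noteq> {} \<and> (\<forall>s\<in>S. \<forall>t\<in>S. (s, t) \<in> (cox_graph W S)\<^sup>*)"


section \<open>Buildings and twin buildings\<close>

locale building = coxeter_system W S for W :: "('w, 'm) monoid_scheme" (structure) and S +
  fixes Ch :: "'c set" and \<delta> :: "'c \<Rightarrow> 'c \<Rightarrow> 'w"
  assumes nonempty: "Ch \<noteq> {}"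
    and dist_closed: "C \<in> Ch \<Longrightarrow> D \<in> Ch \<Longrightarrow> \<delta> C D \<in> carrier W"
    and WD1: "C \<in> Ch \<Longrightarrow> D \<in> Ch \<Longrightarrow> \<delta> C D = \<one> \<longleftrightarrow> C = D"
    and WD2: "C \<in> Ch \<Longrightarrow> D \<in> Ch \<Longrightarrow> C' \<in> Ch \<Longrightarrow> s \<in> S \<Longrightarrow> \<delta> C' C = s \<Longrightarrow>
      \<delta> C' D \<in> {s \<otimes> \<delta> C D, \<delta> C D}"
    and WD2': "C \<in> Ch \<Longrightarrow> D \<in> Ch \<Longrightarrow> C' \<in> Ch \<Longrightarrow> s \<in> S \<Longrightarrow> \<delta> C' C = s \<Longrightarrow>
      cox_length W S (s \<otimes> \<delta> C D) = cox_length W S (\<delta> C D) + 1 \<Longrightarrow> \<delta> C' D = s \<otimes> \<delta> C D"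
    and WD3: "C \<in> Ch \<Longrightarrow> D \<in> Ch \<Longrightarrow> s \<in> S \<Longrightarrow>
      \<exists>C'\<in>Ch. \<delta> C' C = s \<and> \<delta> C' D = s \<otimes> \<delta> C D"

text \<open>The two halves are \<open>Ch True\<close> and \<open>Ch False\<close>; \<open>\<delta>\<close> is meaningful on pairs in the same half and
  the codistance \<open>\<delta>'\<close> on pairs in different halves. Note the side of the multiplication: in
  \<open>Tw2\<close> and \<open>Tw3\<close> a change of the second argument of \<open>\<delta>'\<close> acts from the left, so \<open>\<delta>' C D\<close> is
  the inverse of the codistance in the convention that parallels that of \<open>\<delta>\<close>.\<close>

locale twin_building = coxeter_system W S for W :: "('w, 'm) monoid_scheme" (structure) and S +
  fixes Ch :: "bool \<Rightarrow> 'c set" and \<delta> \<delta>' :: "'c \<Rightarrow> 'c \<Rightarrow> 'w"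
  assumes halves_disjoint: "Ch True \<inter> Ch False = {}"
    and halves_building: "building W S (Ch \<epsilon>) \<delta>"
    and codist_closed: "C \<in> Ch \<epsilon> \<Longrightarrow> D \<in> Ch (\<not> \<epsilon>) \<Longrightarrow> \<delta>' C D \<in> carrier W"
    and Tw1: "C \<in> Ch \<epsilon> \<Longrightarrow> D \<in> Ch (\<not> \<epsilon>) \<Longrightarrow> \<delta>' D C = inv (\<delta>' C D)"
    and Tw2: "C \<in> Ch \<epsilon> \<Longrightarrow> D \<in> Ch (\<not> \<epsilon>) \<Longrightarrow> E \<in> Ch (\<not> \<epsilon>) \<Longrightarrow> s \<in> S \<Longrightarrow> \<delta> D E = s \<Longrightarrow>
      cox_length W S (s \<otimes> \<delta>' C D) + 1 = cox_length W S (\<delta>' C D) \<Longrightarrow> \<delta>' C E = s \<otimes> \<delta>' C D"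
    and Tw3: "C \<in> Ch \<epsilon> \<Longrightarrow> D \<in> Ch (\<not> \<epsilon>) \<Longrightarrow> s \<in> S \<Longrightarrow>
      \<exists>E\<in>Ch (\<not> \<epsilon>). \<delta> D E = s \<and> \<delta>' C E = s \<otimes> \<delta>' C D"

definition chambers :: "(bool \<Rightarrow> 'c set) \<Rightarrow> 'c set" where
  "chambers Ch = Ch True \<union> Ch False"

definition s_adjacent :: "(bool \<Rightarrow> 'c set) \<Rightarrow> ('c \<Rightarrow> 'c \<Rightarrow> 'w) \<Rightarrow> 'w \<Rightarrow> 'c \<Rightarrow> 'c \<Rightarrow> bool" where
  "s_adjacent Ch \<delta> s C D \<longleftrightarrow> (\<exists>\<epsilon>. C \<in> Ch \<epsilon> \<and> D \<in> Ch \<epsilon> \<and> \<delta> C D = s)"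

definition adjacent :: "'w set \<Rightarrow> (bool \<Rightarrow> 'c set) \<Rightarrow> ('c \<Rightarrow> 'c \<Rightarrow> 'w) \<Rightarrow> 'c \<Rightarrow> 'c \<Rightarrow> bool" where
  "adjacent S Ch \<delta> C D \<longleftrightarrow> (\<exists>s\<in>S. s_adjacent Ch \<delta> s C D)"

definition residue_of ::
  "('w, 'm) monoid_scheme \<Rightarrow> (bool \<Rightarrow> 'c set) \<Rightarrow> ('c \<Rightarrow> 'c \<Rightarrow> 'w) \<Rightarrow> 'w set \<Rightarrow> bool \<Rightarrow> 'c set \<Rightarrow> bool"
  where
  "residue_of W Ch \<delta> J \<epsilon> R \<longleftrightarrow> (\<exists>C\<in>Ch \<epsilon>. R = {D \<in> Ch \<epsilon>. \<delta> C D \<in> generate W J})"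

definition opposite ::
  "('w, 'm) monoid_scheme \<Rightarrow> (bool \<Rightarrow> 'c set) \<Rightarrow> ('c \<Rightarrow> 'c \<Rightarrow> 'w) \<Rightarrow> 'c \<Rightarrow> 'c \<Rightarrow> bool" where
  "opposite W Ch \<delta>' C D \<longleftrightarrow> (\<exists>\<epsilon>. C \<in> Ch \<epsilon> \<and> D \<in> Ch (\<not> \<epsilon>) \<and> \<delta>' C D = \<one>\<^bsub>W\<^esub>)"

definition opposite_residues ::
  "('w, 'm) monoid_scheme \<Rightarrow> 'w set \<Rightarrow> (bool \<Rightarrow> 'c set) \<Rightarrow> ('c \<Rightarrow> 'c \<Rightarrow> 'w) \<Rightarrow> ('c \<Rightarrow> 'c \<Rightarrow> 'w) \<Rightarrow>
    'c set \<Rightarrow> 'c set \<Rightarrow> bool" where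
  "opposite_residues W S Ch \<delta> \<delta>' P Q \<longleftrightarrow>
    (\<exists>\<epsilon>. (\<exists>K\<subseteq>S. residue_of W Ch \<delta> K \<epsilon> P) \<and> (\<exists>L\<subseteq>S. residue_of W Ch \<delta> L (\<not> \<epsilon>) Q)) \<and>
    (\<forall>C\<in>P. \<exists>D\<in>Q. opposite W Ch \<delta>' C D)"


section \<open>Automorphisms\<close>

definition twin_automorphism ::
  "('w, 'm) monoid_scheme \<Rightarrow> 'w set \<Rightarrow> (bool \<Rightarrow> 'c set) \<Rightarrow> ('c \<Rightarrow> 'c \<Rightarrow> 'w) \<Rightarrow> ('c \<Rightarrow> 'c \<Rightarrow> 'w) \<Rightarrow>
    ('c \<Rightarrow> 'c) \<Rightarrow> bool" where
  "twin_automorphism W S Ch \<delta> \<delta>' \<theta> \<longleftrightarrow>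
    bij_betw \<theta> (chambers Ch) (chambers Ch) \<and>
    (\<forall>C\<in>chambers Ch. \<forall>D\<in>chambers Ch. adjacent S Ch \<delta> C D \<longleftrightarrow> adjacent S Ch \<delta> (\<theta> C) (\<theta> D)) \<and>
    (\<forall>C\<in>chambers Ch. \<forall>D\<in>chambers Ch.
      opposite W Ch \<delta>' C D \<longleftrightarrow> opposite W Ch \<delta>' (\<theta> C) (\<theta> D))"

text \<open>\<open>\<sigma>\<close> is a label-preserving automorphism of the Coxeter graph through which \<open>\<theta>\<close> acts on
  adjacency types.\<close>

definition induces_type_map ::
  "('w, 'm) monoid_scheme \<Rightarrow> 'w set \<Rightarrow> (bool \<Rightarrow> 'c set) \<Rightarrow> ('c \<Rightarrow> 'c \<Rightarrow> 'w) \<Rightarrow> ('c \<Rightarrow> 'c) \<Rightarrow>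
    ('w \<Rightarrow> 'w) \<Rightarrow> bool" where
  "induces_type_map W S Ch \<delta> \<theta> \<sigma> \<longleftrightarrow>
    bij_betw \<sigma> S S \<and> (\<forall>s\<in>S. \<forall>t\<in>S. cox_m W (\<sigma> s) (\<sigma> t) = cox_m W s t) \<and>
    (\<forall>s\<in>S. \<forall>C D. s_adjacent Ch \<delta> s C D \<longrightarrow> s_adjacent Ch \<delta> (\<sigma> s) (\<theta> C) (\<theta> D))"

definition type_preserving ::
  "('w, 'm) monoid_scheme \<Rightarrow> 'w set \<Rightarrow> (bool \<Rightarrow> 'c set) \<Rightarrow> ('c \<Rightarrow> 'c \<Rightarrow> 'w) \<Rightarrow> ('c \<Rightarrow> 'c) \<Rightarrow> bool"
  where
  "type_preserving W S Ch \<delta> \<theta> \<longleftrightarrow> induces_type_map W S Ch \<delta> \<theta> id"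

definition maps_residues_to_opposites ::
  "('w, 'm) monoid_scheme \<Rightarrow> 'w set \<Rightarrow> (bool \<Rightarrow> 'c set) \<Rightarrow> ('c \<Rightarrow> 'c \<Rightarrow> 'w) \<Rightarrow> ('c \<Rightarrow> 'c \<Rightarrow> 'w) \<Rightarrow>
    ('c \<Rightarrow> 'c) \<Rightarrow> 'w set \<Rightarrow> bool" where
  "maps_residues_to_opposites W S Ch \<delta> \<delta>' \<theta> K \<longleftrightarrow>
    (\<forall>\<epsilon> R. residue_of W Ch \<delta> K \<epsilon> R \<longrightarrow> opposite_residues W S Ch \<delta> \<delta>' R (\<theta> ` R))"

definition maps_chambers_to_opposites ::
  "('w, 'm) monoid_scheme \<Rightarrow> (bool \<Rightarrow> 'c set) \<Rightarrow> ('c \<Rightarrow> 'c \<Rightarrow> 'w) \<Rightarrow> ('c \<Rightarrow> 'c) \<Rightarrow> bool" where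
  "maps_chambers_to_opposites W Ch \<delta>' \<theta> \<longleftrightarrow> (\<forall>C\<in>chambers Ch. opposite W Ch \<delta>' C (\<theta> C))"

end

theory Submission
  imports Defs
begin

text \<open>If \<open>\<theta>\<close> maps all \<open>K\<close>-residues to opposite ones, then counting panels through a chamber shows
  that the image residues again have type \<open>K\<close>, so \<open>\<delta>'(C, \<theta> C)\<close> lies in the parabolic subgroup
  \<open>W\<^sub>K\<close> for every chamber \<open>C\<close>. Given such a \<open>C\<close> with \<open>w = \<delta>'(C, \<theta> C)\<close> and \<open>s \<in> S - K\<close>, choose \<open>D\<close>
  \<open>s\<close>-adjacent to \<open>C\<close> with \<open>\<delta>'(D, \<theta> C) = ws\<close>. Since \<open>\<theta> D\<close> is \<open>t\<close>-adjacent to \<open>\<theta> C\<close> for some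
  \<open>t\<close> and \<open>\<delta>'(D, \<theta> D) \<in> W\<^sub>K\<close>, necessarily \<open>t = s\<close> and \<open>sws \<in> W\<^sub>K\<close>, which forces \<open>w\<close> into the
  parabolic subgroup of the elements of \<open>K\<close> commuting with \<open>s\<close>. For a smallest such \<open>K\<close>,
  irreducibility gives \<open>K = {}\<close>. An adjacency-preserving bijection need not act on types through a
  single permutation of \<open>S\<close>, and the argument does not assume that it does.\<close>

section \<open>Coxeter groups\<close>

text \<open>For a word s_1 ... s_n the i-th entry unfolds to s_1 ... s_{i-1} s_i (s_1 ...
  s_{i-1})^{-1}. Repetitions are kept because the parity of multiplicities is the invariant that
  leads to the exchange condition.\<close>

fun reflections :: "('w, 'm) monoid_scheme \<Rightarrow> 'w list \<Rightarrow> 'w list" where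
  "reflections W [] = []"
| "reflections W (s # us) = s # map (\<lambda>r. s \<otimes>\<^bsub>W\<^esub> r \<otimes>\<^bsub>W\<^esub> inv\<^bsub>W\<^esub> s) (reflections W us)"

lemma word_prod_Nil [simp]: "word_prod W [] = \<one>\<^bsub>W\<^esub>"
  by (simp add: word_prod_def)

lemma word_prod_Cons [simp]: "word_prod W (s # us) = s \<otimes>\<^bsub>W\<^esub> word_prod W us"
  by (simp add: word_prod_def)

context group
begin

lemma word_prod_closed [simp]: "set us \<subseteq> carrier G \<Longrightarrow> word_prod G us \<in> carrier G"
  by (induction us) auto

lemma word_prod_append:
  "set us \<subseteq> carrier G \<Longrightarrow> set vs \<subseteq> carrier G \<Longrightarrow>
    word_prod G (us @ vs) = word_prod G us \<otimes> word_prod G vs"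
  by (induction us) (auto simp: m_assoc)

lemma reflections_closed: "set us \<subseteq> carrier G \<Longrightarrow> set (reflections G us) \<subseteq> carrier G"
  by (induction us) auto

lemma reflections_append:
  assumes "set us \<subseteq> carrier G" "set vs \<subseteq> carrier G"
  shows "reflections G (us @ vs) = reflections G us @
    map (\<lambda>r. word_prod G us \<otimes> r \<otimes> inv (word_prod G us)) (reflections G vs)"
  using assms
proof (induction us)
  case Nil
  then show ?case
    using reflections_closed[OF Nil(2)] by (auto intro!: map_idI[symmetric])
next
  case (Cons s us)
  then show ?case
    using reflections_closed[OF Cons.prems(2)]
    by (auto simp: m_assoc inv_mult_group subset_iff)
qed

lemma count_list_map_conj:
  assumes "u \<in> carrier G" "r \<in> carrier G" "set xs \<subseteq> carrier G"
  shows "count_list (map (\<lambda>x. u \<otimes> x \<otimes> inv u) xs) r = count_list xs (inv u \<otimes> r \<otimes> u)"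
  using assms(3)
proof (induction xs)
  case (Cons x xs)
  have "u \<otimes> x \<otimes> inv u = r \<longleftrightarrow> x = inv u \<otimes> r \<otimes> u"
  proof
    assume "u \<otimes> x \<otimes> inv u = r"
    then have "inv u \<otimes> r \<otimes> u = inv u \<otimes> (u \<otimes> x \<otimes> inv u) \<otimes> u" by simp
    also have "\<dots> = (inv u \<otimes> u) \<otimes> x \<otimes> (inv u \<otimes> u)"
      using assms Cons.prems by (simp only: m_assoc m_closed inv_closed list.set insert_subset)
    finally show "x = inv u \<otimes> r \<otimes> u" using assms Cons.prems by simp
  next
    assume "x = inv u \<otimes> r \<otimes> u"
    then have "u \<otimes> x \<otimes> inv u = u \<otimes> (inv u \<otimes> r \<otimes> u) \<otimes> inv u" by simp
    also have "\<dots> = (u \<otimes> inv u) \<otimes> r \<otimes> (u \<otimes> inv u)"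
      using assms by (simp only: m_assoc m_closed inv_closed)
    finally show "u \<otimes> x \<otimes> inv u = r" using assms by simp
  qed
  then show ?case using Cons by auto
qed simp

end

context coxeter_system
begin

abbreviation len :: "'w \<Rightarrow> nat" where
  "len \<equiv> cox_length W S"

lemma gens_carrier [simp]: "s \<in> S \<Longrightarrow> s \<in> carrier W"
  using gens_closed by auto

lemma words_carrier [simp]: "set us \<subseteq> S \<Longrightarrow> set us \<subseteq> carrier W"
  using gens_closed by auto

lemma gens_inv [simp]: "s \<in> S \<Longrightarrow> inv s = s"
  by (simp add: gens_involution inv_equality)

lemma gens_cancel [simp]: "s \<in> S \<Longrightarrow> w \<in> carrier W \<Longrightarrow> s \<otimes> (s \<otimes> w) = w"
  by (simp add: gens_involution flip: m_assoc)

lemma gens_cancel_right: "s \<in> S \<Longrightarrow> w \<in> carrier W \<Longrightarrow> (w \<otimes> s) \<otimes> s = w"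
  by (simp add: gens_involution m_assoc)

text \<open>Splitting off the first \<open>[s, t]\<close> conjugates the remaining reflections by
  st. This raises the exponent by two, because conjugation by s inverts st.\<close>

lemma reflections_alternating:
  assumes "s \<in> S" "t \<in> S"
  shows "reflections W (concat (replicate n [s, t])) = map (\<lambda>i. (s \<otimes> t) [^] i \<otimes> s) [0..<2 * n]"
proof (induction n)
  case (Suc n)
  have closed: "set (concat (replicate n [s, t])) \<subseteq> carrier W" "set [s, t] \<subseteq> carrier W"
    using assms by (auto split: if_splits)
  have conj: "(s \<otimes> t) \<otimes> ((s \<otimes> t) [^] i \<otimes> s) \<otimes> inv (s \<otimes> t) = (s \<otimes> t) [^] (i + 2) \<otimes> s" for i :: nat
  proof -
    have "(s \<otimes> t) \<otimes> ((s \<otimes> t) [^] i \<otimes> s) \<otimes> inv (s \<otimes> t)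
      = ((s \<otimes> t) \<otimes> (s \<otimes> t) [^] i) \<otimes> (s \<otimes> t) \<otimes> s"
      using assms by (simp add: inv_mult_group m_assoc)
    also have "(s \<otimes> t) \<otimes> (s \<otimes> t) [^] i = (s \<otimes> t) [^] (Suc i)"
      using assms by (intro nat_pow_Suc2[symmetric]) simp
    finally show ?thesis using assms by simp
  qed
  have "[0..<2 * Suc n] = 0 # Suc 0 # map (\<lambda>i. i + 2) [0..<2 * n]"
    using map_add_upt[of 2 "2 * n"]
    by (simp add: upt_conv_Cons numeral_2_eq_2 del: upt_Suc)
  moreover have "concat (replicate (Suc n) [s, t]) = [s, t] @ concat (replicate n [s, t])"
    by simp
  ultimately show ?case
    using assms closed by (simp only: reflections_append Suc.IH) (simp add: conj)
qed simp

text \<open>The 2m listed reflections have period m = m(s,t), so the two halves of the list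
  coincide. If st has infinite order, m is 0 and the list is empty.\<close>

lemma even_count_relator:
  assumes "s \<in> S" "t \<in> S"
  shows "even (count_list (reflections W (concat (replicate (cox_m W s t) [s, t]))) r)"
proof -
  let ?m = "cox_m W s t" and ?f = "\<lambda>i. (s \<otimes> t) [^] i \<otimes> s"
  have "[0..<2 * ?m] = [0..<?m] @ map (\<lambda>i. i + ?m) [0..<?m]"
    by (simp add: map_add_upt mult_2 upt_add_eq_append[of 0, simplified])
  moreover have "?f (i + ?m) = ?f i" for i :: nat
    using assms by (simp add: cox_m_def nat_pow_mult[symmetric] pow_ord_eq_1)
  ultimately have "map ?f [0..<2 * ?m] = map ?f [0..<?m] @ map ?f [0..<?m]"
    by simp
  then show ?thesis
    using assms by (simp only: reflections_alternating) simp
qed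

lemma word_prod_relator:
  assumes "s \<in> S" "t \<in> S"
  shows "word_prod W (concat (replicate (cox_m W s t) [s, t])) = \<one>"
proof -
  have "word_prod W (concat (replicate n [s, t])) = (s \<otimes> t) [^] n" for n
  proof (induction n)
    case (Suc n)
    have "(s \<otimes> t) [^] Suc n = (s \<otimes> t) \<otimes> (s \<otimes> t) [^] n"
      using assms by (intro nat_pow_Suc2) simp
    then show ?case using assms Suc by (simp add: m_assoc)
  qed simp
  then show ?thesis using assms by (simp add: cox_m_def pow_ord_eq_1)
qed

text \<open>A relator has product 1, so inserting it leaves the reflections of the remaining letters
  unchanged. It only adds conjugates of its own reflections, each with even multiplicity, and its
  length is even.\<close>

lemma cox_equiv_parity:
  assumes "cox_equiv W S us vs"
  shows "set us \<subseteq> S \<and> set vs \<subseteq> S \<and> (even (length us) \<longleftrightarrow> even (length vs)) \<and>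
    (\<forall>r\<in>carrier W. even (count_list (reflections W us) r) \<longleftrightarrow> even (count_list (reflections W vs) r))"
  using assms
proof induction
  case (relator s t us vs)
  let ?rel = "concat (replicate (cox_m W s t) [s, t])"
  have rel: "set ?rel \<subseteq> S" using relator by (auto split: if_splits)
  have "length ?rel = 2 * cox_m W s t" by (simp add: length_concat sum_list_replicate)
  moreover have "even (count_list (reflections W (us @ ?rel @ vs)) r) \<longleftrightarrow>
      even (count_list (reflections W (us @ vs)) r)" if r: "r \<in> carrier W" for r
  proof -
    let ?u = "word_prod W us"
    have u: "?u \<in> carrier W" using relator by simp
    have "reflections W (?rel @ vs) = reflections W ?rel @ reflections W vs"
      using relator rel reflections_closed[of vs]
      by (subst reflections_append) (auto simp: word_prod_relator intro!: map_idI)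
    then have "count_list (reflections W (us @ ?rel @ vs)) r =
        count_list (reflections W (us @ vs)) r + count_list (reflections W ?rel) (inv ?u \<otimes> r \<otimes> ?u)"
      using relator rel u r
      by (subst (1 2) reflections_append)
        (simp_all add: count_list_map_conj reflections_closed)
    then show ?thesis using even_count_relator[OF relator(1,2)] by simp
  qed
  ultimately show ?case using relator rel by auto
qed auto

section \<open>Length, parity and the exchange condition\<close>

lemma len_word_prod_le: "set us \<subseteq> S \<Longrightarrow> len (word_prod W us) \<le> length us"
  unfolding cox_length_def by (rule Least_le) auto

lemma generate_words:
  assumes "K \<subseteq> S"
  shows "w \<in> generate W K \<longleftrightarrow> (\<exists>us. set us \<subseteq> K \<and> word_prod W us = w)"
proof
  assume "w \<in> generate W K"
  then show "\<exists>us. set us \<subseteq> K \<and> word_prod W us = w"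
  proof induction
    case one
    show ?case by (rule exI[of _ "[]"]) simp
  next
    case (incl s)
    then show ?case using assms by (intro exI[of _ "[s]"]) auto
  next
    case (inv s)
    then show ?case using assms by (intro exI[of _ "[s]"]) auto
  next
    case (eng w v)
    then obtain us vs where "set us \<subseteq> K" "word_prod W us = w" "set vs \<subseteq> K" "word_prod W vs = v"
      by auto
    then show ?case using assms gens_closed
      by (intro exI[of _ "us @ vs"]) (auto simp: word_prod_append)
  qed
next
  assume "\<exists>us. set us \<subseteq> K \<and> word_prod W us = w"
  then obtain us where "set us \<subseteq> K" "word_prod W us = w" by auto
  then show "w \<in> generate W K"
    by (induction us arbitrary: w) (auto intro: generate.intros)
qed

lemma obtain_reduced_word:
  assumes "w \<in> carrier W"
  obtains us where "set us \<subseteq> S" "word_prod W us = w" "length us = len w"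
proof -
  have "\<exists>n us. set us \<subseteq> S \<and> length us = n \<and> word_prod W us = w"
    using generate_words[of S w] gens_generate assms by auto
  then have "\<exists>us. set us \<subseteq> S \<and> length us = len w \<and> word_prod W us = w"
    unfolding cox_length_def by (rule LeastI_ex)
  then show thesis using that by auto
qed

lemma even_len:
  assumes "set us \<subseteq> S"
  shows "even (len (word_prod W us)) \<longleftrightarrow> even (length us)"
proof -
  obtain vs where "set vs \<subseteq> S" "word_prod W vs = word_prod W us" "length vs = len (word_prod W us)"
    using obtain_reduced_word[of "word_prod W us"] assms by auto
  then show ?thesis using presentation[of vs us] assms cox_equiv_parity by metis
qed

text \<open>The change is at most one in both directions, since s is an involution, and
  \<open>even_len\<close> excludes equality.\<close>

lemma len_gen_mult:
  assumes "s \<in> S" "w \<in> carrier W"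
  shows "len (s \<otimes> w) = len w + 1 \<or> len (s \<otimes> w) + 1 = len w"
proof -
  have le: "len (s \<otimes> v) \<le> len v + 1" if v: "v \<in> carrier W" for v
  proof -
    obtain us where "set us \<subseteq> S" "word_prod W us = v" "length us = len v"
      using obtain_reduced_word[OF v] .
    then show ?thesis using len_word_prod_le[of "s # us"] assms by simp
  qed
  obtain us where "set us \<subseteq> S" "word_prod W us = w" "length us = len w"
    using obtain_reduced_word[OF assms(2)] .
  then have "even (len (s \<otimes> w)) \<longleftrightarrow> \<not> even (len w)"
    using even_len[of "s # us"] assms by simp
  moreover have "len (s \<otimes> w) \<le> len w + 1" "len w \<le> len (s \<otimes> w) + 1"
    using le[of w] le[of "s \<otimes> w"] assms by auto
  ultimately show ?thesis by presburger
qed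

lemma len_one [simp]: "len \<one> = 0"
  using len_word_prod_le[of "[]"] by simp

lemma len_gen [simp]: "s \<in> S \<Longrightarrow> len s = 1"
  using len_gen_mult[of s \<one>] by simp

lemma len_two_gens:
  assumes "s \<in> S" "t \<in> S" "s \<noteq> t"
  shows "len (s \<otimes> t) = 2"
proof (rule ccontr)
  assume "len (s \<otimes> t) \<noteq> 2"
  then have "len (s \<otimes> t) = 0" using len_gen_mult[of s t] assms by simp
  then obtain us where "word_prod W us = s \<otimes> t" "length us = 0"
    using obtain_reduced_word[of "s \<otimes> t"] assms by auto
  then have "s \<otimes> t = \<one>" by simp
  then show False using assms by (metis gens_carrier gens_inv inv_equality)
qed

text \<open>If r arises at the letter y after the prefix u, then r = u y u^{-1}, so left
  multiplication by r cancels this y.\<close>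

lemma reflection_deletes:
  assumes "set us \<subseteq> S" "r \<in> set (reflections W us)"
  shows "\<exists>xs y ys. us = xs @ y # ys \<and> r \<otimes> word_prod W us = word_prod W (xs @ ys)"
  using assms
proof (induction us arbitrary: r)
  case (Cons s us)
  have s: "s \<in> S" and us: "set us \<subseteq> S" using Cons.prems by auto
  consider "r = s" | r' where "r' \<in> set (reflections W us)" "r = s \<otimes> r' \<otimes> inv s"
    using Cons.prems by auto
  then show ?case
  proof cases
    case 1
    then have "s # us = [] @ s # us \<and> r \<otimes> word_prod W (s # us) = word_prod W ([] @ us)"
      using s us by simp
    then show ?thesis by blast
  next
    case 2
    then obtain xs y ys where *: "us = xs @ y # ys" "r' \<otimes> word_prod W us = word_prod W (xs @ ys)"
      using Cons.IH us by blast
    have "r' \<in> carrier W" using 2 reflections_closed[of us] us by auto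
    then have "r \<otimes> word_prod W (s # us) = s \<otimes> (r' \<otimes> word_prod W us)"
      using 2 s us by (simp add: m_assoc)
    then have "s # us = (s # xs) @ y # ys \<and> r \<otimes> word_prod W (s # us) = word_prod W ((s # xs) @ ys)"
      using * by simp
    then show ?thesis by blast
  qed
qed simp

text \<open>The parity of the multiplicity of \<open>s\<close> among the reflections of a word depends only on the
  product, and each reflection that occurs deletes a letter.\<close>

lemma exchange:
  assumes "set us \<subseteq> S" "s \<in> S" "len (s \<otimes> word_prod W us) < len (word_prod W us)"
  shows "\<exists>xs y ys. us = xs @ y # ys \<and> s \<otimes> word_prod W us = word_prod W (xs @ ys)"
proof -
  let ?w = "word_prod W us"
  have w: "?w \<in> carrier W" using assms by simp
  obtain vs where vs: "set vs \<subseteq> S" "word_prod W vs = s \<otimes> ?w" "length vs = len (s \<otimes> ?w)"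
    using obtain_reduced_word[of "s \<otimes> ?w"] assms by auto
  \<comment> \<open>Otherwise deleting a letter of the reduced word \<open>vs\<close> for
    \<open>s \<otimes> ?w\<close> would give a word for \<open>?w\<close> of length below
    \<open>len ?w\<close>.\<close>
  have "s \<notin> set (reflections W vs)"
  proof
    assume "s \<in> set (reflections W vs)"
    then obtain xs y ys where *: "vs = xs @ y # ys" "s \<otimes> word_prod W vs = word_prod W (xs @ ys)"
      using reflection_deletes vs by blast
    then have "word_prod W (xs @ ys) = ?w" using vs assms w by simp
    then have "len ?w \<le> length (xs @ ys)"
      using len_word_prod_le[of "xs @ ys"] vs * by simp
    then show False using * vs assms by simp
  qed
  \<comment> \<open>The leading s is the only occurrence: a conjugate by s equals s only if it is
    the conjugate of s itself.\<close>
  then have "count_list (reflections W (s # vs)) s = 1"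
    using assms vs reflections_closed[of vs]
    by (simp add: count_list_map_conj gens_involution m_assoc del: gens_inv)
  moreover have "cox_equiv W S (s # vs) us"
    using presentation[of "s # vs" us] assms vs w by simp
  ultimately have "odd (count_list (reflections W us) s)"
    using cox_equiv_parity assms by (metis gens_carrier odd_one)
  then have "s \<in> set (reflections W us)"
    by (metis count_notin even_zero)
  then show ?thesis using reflection_deletes assms by blast
qed

section \<open>Parabolic subgroups\<close>

lemma parabolic_carrier: "K \<subseteq> S \<Longrightarrow> w \<in> generate W K \<Longrightarrow> w \<in> carrier W"
  using generate_in_carrier[of K w] gens_closed by blast

lemma parabolic_inv: "K \<subseteq> S \<Longrightarrow> w \<in> generate W K \<Longrightarrow> inv w \<in> generate W K"
  using generate_m_inv_closed[of K w] gens_closed by blast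

text \<open>\<open>exchange\<close> applies to an arbitrary, possibly non-reduced, word over
  \<open>K\<close> for w, and deleting a letter leaves a word over \<open>K\<close>.\<close>

lemma exchange_parabolic:
  assumes "K \<subseteq> S" "w \<in> generate W K" "s \<in> S" "len (s \<otimes> w) < len w"
  shows "s \<otimes> w \<in> generate W K"
proof -
  obtain us where us: "set us \<subseteq> K" "word_prod W us = w"
    using assms generate_words by blast
  then obtain xs y ys where "us = xs @ y # ys" "s \<otimes> w = word_prod W (xs @ ys)"
    using exchange[of us s] assms by blast
  then show ?thesis using us assms generate_words[of K "s \<otimes> w"]
    by (metis Un_subset_iff set_append set_subset_Cons subset_trans)
qed

text \<open>A word over \<open>K\<close> is reduced from its end: if prepending a letter shortens
  the product, \<open>exchange\<close> deletes a letter of the reduced tail instead, so all letters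
  stay in \<open>K\<close>.\<close>

lemma parabolic_reduced_word:
  assumes "K \<subseteq> S" "w \<in> generate W K"
  obtains us where "set us \<subseteq> K" "word_prod W us = w" "length us = len w"
proof -
  obtain us where us: "set us \<subseteq> K" "word_prod W us = w"
    using assms generate_words by blast
  then have "\<exists>us. set us \<subseteq> K \<and> word_prod W us = w \<and> length us = len w"
  proof (induction us arbitrary: w)
    case (Cons k us)
    let ?v = "word_prod W us"
    have k: "k \<in> S" "k \<in> K" using Cons.prems assms by auto
    obtain vs where vs: "set vs \<subseteq> K" "word_prod W vs = ?v" "length vs = len ?v"
      using Cons by auto
    have vS: "set vs \<subseteq> S" using vs assms by auto
    then have v: "?v \<in> carrier W" using vs by (metis word_prod_closed words_carrier)
    from len_gen_mult[OF k(1) v] show ?case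
    proof
      assume "len (k \<otimes> ?v) = len ?v + 1"
      then show ?case using k vs Cons.prems by (intro exI[of _ "k # vs"]) auto
    next
      assume *: "len (k \<otimes> ?v) + 1 = len ?v"
      then obtain xs y ys where "vs = xs @ y # ys" "k \<otimes> ?v = word_prod W (xs @ ys)"
        using exchange[OF vS k(1)] vs by auto
      then show ?case using * vs Cons.prems by (intro exI[of _ "xs @ ys"]) auto
    qed
  qed (auto intro: exI[of _ "[]"])
  then show thesis using that by auto
qed

text \<open>A reduced word over \<open>K\<close> for s consists of one letter, which is s.\<close>

lemma gen_in_parabolic:
  assumes "K \<subseteq> S" "s \<in> S" "s \<in> generate W K"
  shows "s \<in> K"
proof -
  obtain us where "set us \<subseteq> K" "word_prod W us = s" "length us = len s"
    using parabolic_reduced_word[OF assms(1,3)] .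
  then show ?thesis using assms by (cases us) auto
qed

lemma generate_cancel_right:
  assumes "K \<subseteq> S" "v \<in> generate W K" "x \<in> carrier W" "x \<otimes> v \<in> generate W K"
  shows "x \<in> generate W K"
proof -
  have "v \<in> carrier W" using assms parabolic_carrier by blast
  then have "x = (x \<otimes> v) \<otimes> inv v" using assms by (simp add: m_assoc)
  then show ?thesis using assms parabolic_inv generate.eng by metis
qed

lemma generate_cancel_left:
  assumes "K \<subseteq> S" "v \<in> generate W K" "x \<in> carrier W" "v \<otimes> x \<in> generate W K"
  shows "x \<in> generate W K"
proof -
  have "v \<in> carrier W" using assms parabolic_carrier by blast
  then have "x = inv v \<otimes> (v \<otimes> x)" using assms by (simp flip: m_assoc)
  then show ?thesis using assms parabolic_inv generate.eng by metis
qed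

lemma len_inv:
  assumes "w \<in> carrier W"
  shows "len (inv w) = len w"
proof -
  have "len (inv v) \<le> len v" if v: "v \<in> carrier W" for v
  proof -
    obtain us where us: "set us \<subseteq> S" "word_prod W us = v" "length us = len v"
      using obtain_reduced_word[OF v] .
    have "word_prod W (rev us) = inv (word_prod W us)"
      using us(1) by (induction us) (auto simp: word_prod_append inv_mult_group)
    then show ?thesis using len_word_prod_le[of "rev us"] us by simp
  qed
  from this[of w] this[of "inv w"] show ?thesis using assms by simp
qed

text \<open>Otherwise s would shorten \<open>inv w\<close> from the left, and
  \<open>exchange_parabolic\<close> would put s into the subgroup generated by \<open>K\<close>. The
  passage to inverses is made because the exchange condition is formulated for left
  multiplication.\<close>

lemma len_parabolic_mult_gen:
  assumes "K \<subseteq> S" "s \<in> S - K" "w \<in> generate W K"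
  shows "len (w \<otimes> s) = len w + 1"
proof (rule ccontr)
  assume neq: "len (w \<otimes> s) \<noteq> len w + 1"
  have w: "w \<in> carrier W" "inv w \<in> generate W K"
    using assms parabolic_carrier parabolic_inv by auto
  have "inv (w \<otimes> s) = s \<otimes> inv w" using w assms by (simp add: inv_mult_group)
  then have "len (s \<otimes> inv w) \<noteq> len (inv w) + 1"
    using neq len_inv[of "w \<otimes> s"] len_inv[of w] w assms by auto
  then have "len (s \<otimes> inv w) < len (inv w)"
    using len_gen_mult[of s "inv w"] w assms by auto
  then have "s \<otimes> inv w \<in> generate W K"
    using exchange_parabolic assms w by blast
  then have "s \<in> generate W K"
    using generate_cancel_right[of K "inv w" s] assms w by auto
  then show False using gen_in_parabolic assms by auto
qed

text \<open>The first letter k' of a reduced word over \<open>K\<close> for y = sks shortens ys =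
  sk. Exchange in the two-letter word sk leaves k or s; the first case gives k' = s, contrary to s
  lying outside \<open>K\<close>, and the second gives k' = sks, which forces k' = k.\<close>

lemma conj_gen_in_parabolic_commutes:
  assumes K: "K \<subseteq> S" and s: "s \<in> S - K" and k: "k \<in> K" and y: "s \<otimes> k \<otimes> s \<in> generate W K"
  shows "s \<otimes> k = k \<otimes> s"
proof -
  let ?y = "s \<otimes> k \<otimes> s"
  have sS: "s \<in> S" and kS: "k \<in> S" using s k K by auto
  obtain us where us: "set us \<subseteq> K" "word_prod W us = ?y" "length us = len ?y"
    using parabolic_reduced_word[OF K y] .
  have ys: "?y \<otimes> s = s \<otimes> k" using sS kS by (simp add: m_assoc gens_involution)
  show ?thesis
  proof (cases us)
    case Nil
    then have "?y = \<one>" using us by simp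
    then have "s \<otimes> k = s" using ys sS by simp
    then have "k = \<one>" using sS kS by simp
    then show ?thesis using gens_nontrivial kS by blast
  next
    case (Cons k' vs)
    then have k': "k' \<in> K" "k' \<in> S" "set vs \<subseteq> K" "set vs \<subseteq> S" using us K by auto
    let ?v = "word_prod W vs"
    have v: "?v \<in> carrier W" "?v \<in> generate W K" using k' K generate_words by auto
    have yv: "?y = k' \<otimes> ?v" using us Cons by simp
    have "k' \<otimes> (s \<otimes> k) = ?v \<otimes> s"
      using ys yv k' v sS by (metis gens_cancel gens_carrier m_assoc m_closed)
    moreover have "len (?v \<otimes> s) = len ?v + 1" "len (?y \<otimes> s) = len ?y + 1"
      using len_parabolic_mult_gen K s v y by auto
    moreover have "len ?v < len ?y" using len_word_prod_le[of vs] k' us Cons by simp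
    \<comment> \<open>Both v and y gain exactly one from s on the right, and v is shorter than y;
      hence k'sk = vs is shorter than sk = ys.\<close>
    ultimately have "len (k' \<otimes> word_prod W [s, k]) < len (word_prod W [s, k])"
      using ys sS kS by simp
    then obtain xs z zs where *: "[s, k] = xs @ z # zs" "k' \<otimes> word_prod W [s, k] = word_prod W (xs @ zs)"
      using exchange[of "[s, k]" k'] k' sS kS by (metis empty_subsetI insert_subset list.set)
    then have "xs @ zs = [k] \<or> xs @ zs = [s]"
      by (cases xs) (auto simp: Cons_eq_append_conv)
    moreover have "word_prod W [s, k] = s \<otimes> k" using sS kS by simp
    ultimately have "k' \<otimes> (s \<otimes> k) = k \<or> k' \<otimes> (s \<otimes> k) = s"
      using *(2) sS kS by (metis gens_carrier r_one word_prod_Cons word_prod_Nil)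
    then show ?thesis
    proof
      assume "k' \<otimes> (s \<otimes> k) = k"
      then have "k' \<otimes> s = \<one>"
        using k' sS kS by (metis gens_carrier m_assoc m_closed r_cancel_one')
      then have "k' = s" using k' sS by (metis gens_carrier gens_inv inv_equality)
      then show ?thesis using k' s by auto
    next
      assume eq: "k' \<otimes> (s \<otimes> k) = s"
      then have sk: "s \<otimes> k = k' \<otimes> s" using k' sS kS by (metis gens_cancel gens_carrier m_closed)
      then have "k' = s \<otimes> (k \<otimes> s)" using k' sS kS gens_cancel_right
        by (metis gens_carrier m_assoc)
      then have "k' = word_prod W [s, k, s]" using sS kS by simp
      then have "k' \<in> generate W {s, k}"
        using generate_words[of "{s, k}" k'] sS kS
        by (metis empty_subsetI insert_subset list.set(1) list.simps(15) order_refl insertCI)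
      \<comment> \<open>A generator in the subgroup generated by s and k is s or k, and k' lies in
        \<open>K\<close> while s does not.\<close>
      then have "k' = k" using gen_in_parabolic[of "{s, k}" k'] k' s sS kS by auto
      then show ?thesis using sk by simp
    qed
  qed
qed

text \<open>The equation expresses that conjugation by s takes the product of \<open>us\<close> to w
  inside the same parabolic subgroup. In this form it survives an induction on \<open>us\<close>:
  once the first letter k commutes with s, the remaining word satisfies the same equation with kw in
  place of w.\<close>

lemma parabolic_twisted_commute:
  assumes K: "K \<subseteq> S" and s: "s \<in> S - K" and us: "set us \<subseteq> K" "length us = len (word_prod W us)"
    and w: "w \<in> generate W K" "s \<otimes> w = word_prod W us \<otimes> s"
  shows "\<forall>k\<in>set us. s \<otimes> k = k \<otimes> s"
  using us w
proof (induction us arbitrary: w)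
  case (Cons k us)
  let ?v = "word_prod W us" and ?x = "s \<otimes> w"
  have sS: "s \<in> S" and kS: "k \<in> S" and kK: "k \<in> K" and usS: "set us \<subseteq> S"
    using s K Cons.prems by auto
  have wc: "w \<in> carrier W" using parabolic_carrier K Cons.prems by blast
  have vK: "?v \<in> generate W K" "k \<otimes> ?v \<in> generate W K"
    using generate_words[OF K, of ?v] Cons.prems(1) by (auto intro: generate.intros)
  have vc: "?v \<in> carrier W" using usS by simp
  have red: "length us = len ?v"
    using Cons.prems(2) len_word_prod_le[OF usS] len_gen_mult[OF kS vc] by auto
  have x: "?x = k \<otimes> ?v \<otimes> s" using Cons.prems by simp
  have kx: "k \<otimes> ?x = ?v \<otimes> s" using x kS sS vc by (simp add: m_assoc)
  \<comment> \<open>Here kx = vs and x = kvs; s adds one to the length of both v and kv, and kv is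
    longer than v because the word is reduced.\<close>
  have "len (k \<otimes> ?x) < len ?x"
    using kx x len_parabolic_mult_gen[OF K s vK(1)] len_parabolic_mult_gen[OF K s vK(2)]
      Cons.prems(2) red by simp
  moreover obtain ws where ws: "set ws \<subseteq> K" "word_prod W ws = w"
    using generate_words[OF K] Cons.prems by blast
  moreover have wsS: "set ws \<subseteq> S" using ws K by auto
  ultimately obtain xs z zs where *: "s # ws = xs @ z # zs" "k \<otimes> ?x = word_prod W (xs @ zs)"
    using exchange[of "s # ws" k] sS kS by auto
  \<comment> \<open>Exchange deletes a letter of the word \<open>s # ws\<close> for x. Deleting the
    leading s would put s into the parabolic subgroup; deleting a letter of \<open>ws\<close> gives
    ksw = su with u in it, hence sks = u w^{-1}.\<close>
  have "s \<otimes> k \<otimes> s \<in> generate W K"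
  proof (cases xs)
    case Nil
    then have "k \<otimes> ?x = w" using * ws by simp
    then have "?v \<otimes> s \<in> generate W K" using kx Cons.prems by simp
    then have "s \<in> generate W K" using generate_cancel_left[OF K vK(1)] sS by simp
    then show ?thesis using gen_in_parabolic K s by auto
  next
    case (Cons s' xs')
    let ?u = "word_prod W (xs' @ zs)"
    have "s' = s" "set (xs' @ zs) \<subseteq> K" using Cons * ws by auto
    then have u: "k \<otimes> (s \<otimes> w) = s \<otimes> ?u" "?u \<in> generate W K"
      using * Cons generate_words[OF K, of ?u] by (simp, blast)
    have uc: "?u \<in> carrier W" using u parabolic_carrier K by blast
    have "s \<otimes> k \<otimes> s \<otimes> w = s \<otimes> (k \<otimes> (s \<otimes> w))" using sS kS wc by (simp add: m_assoc)
    then have "s \<otimes> k \<otimes> s \<otimes> w = ?u" using u sS uc by simp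
    then show ?thesis using generate_cancel_right[OF K \<open>w \<in> generate W K\<close>] u sS kS by simp
  qed
  then have comm: "s \<otimes> k = k \<otimes> s"
    using conj_gen_in_parabolic_commutes[OF K s kK] by simp
  have "s \<otimes> (k \<otimes> w) = k \<otimes> ?x"
    using comm sS kS wc by (simp flip: m_assoc)
  then have "s \<otimes> (k \<otimes> w) = ?v \<otimes> s" using kx by simp
  moreover have "k \<otimes> w \<in> generate W K"
    using kK Cons.prems by (auto intro: generate.intros)
  moreover have "set us \<subseteq> K" using Cons.prems(1) by simp
  ultimately have "\<forall>k\<in>set us. s \<otimes> k = k \<otimes> s" using red by (intro Cons.IH)
  then show ?case using comm by (metis set_ConsD)
qed simp

lemma parabolic_conj_gen:
  assumes K: "K \<subseteq> S" and s: "s \<in> S - K" and w: "w \<in> generate W K" and "s \<otimes> w \<otimes> s \<in> generate W K"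
  shows "w \<in> generate W {k \<in> K. s \<otimes> k = k \<otimes> s}"
proof -
  have sS: "s \<in> S" and wc: "w \<in> carrier W" using s w K parabolic_carrier by auto
  obtain us where us: "set us \<subseteq> K" "word_prod W us = w" "length us = len w"
    using parabolic_reduced_word[OF K w] .
  \<comment> \<open>In the twisted equation sws takes the role of w, and a reduced word for w that
    of \<open>us\<close>.\<close>
  have "s \<otimes> (s \<otimes> w \<otimes> s) = word_prod W us \<otimes> s" using sS wc us(2) by (simp add: m_assoc)
  moreover have "length us = len (word_prod W us)" using us by simp
  ultimately have "\<forall>k\<in>set us. s \<otimes> k = k \<otimes> s"
    using parabolic_twisted_commute[OF K s us(1) _ assms(4)] by blast
  then have "set us \<subseteq> {k \<in> K. s \<otimes> k = k \<otimes> s}" using us(1) by blast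
  moreover have "{k \<in> K. s \<otimes> k = k \<otimes> s} \<subseteq> S" using K by blast
  ultimately show ?thesis using generate_words us(2) by blast
qed

section \<open>Commuting generators and irreducibility\<close>

lemma commuting_not_edge:
  assumes "s \<in> S" "t \<in> S" "s \<otimes> t = t \<otimes> s"
  shows "(s, t) \<notin> cox_graph W S"
proof -
  have "(s \<otimes> t) [^] (2::nat) = s \<otimes> t \<otimes> (s \<otimes> t)"
    using assms(1,2) by (simp add: numeral_2_eq_2)
  also have "\<dots> = s \<otimes> t \<otimes> (t \<otimes> s)" using assms(3) by simp
  also have "\<dots> = \<one>" using assms(1,2) by (simp add: m_assoc gens_involution)
  finally have "(s \<otimes> t) [^] (2::nat) = \<one>" .
  then have "ord (s \<otimes> t) dvd 2" using assms pow_eq_id by auto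
  \<comment> \<open>The value 0 has to be excluded too, since it encodes infinite order and would
    count as an edge.\<close>
  then have "ord (s \<otimes> t) \<le> 2" "ord (s \<otimes> t) \<noteq> 0" using dvd_imp_le by (auto intro: ccontr)
  then show ?thesis by (auto simp: cox_graph_def cox_m_def)
qed

text \<open>A path in the Coxeter graph leaving \<open>K\<close> would cross an edge from
  \<open>K\<close> to its complement, but the ends of such an edge would commute.\<close>

lemma irreducible_no_commuting_split:
  assumes "cox_irreducible W S" "K \<subset> S" "\<And>k s. k \<in> K \<Longrightarrow> s \<in> S - K \<Longrightarrow> s \<otimes> k = k \<otimes> s"
  shows "K = {}"
proof (rule ccontr)
  assume "K \<noteq> {}"
  then obtain k s where k: "k \<in> K" and s: "s \<in> S - K" using assms by auto
  then have "(k, s) \<in> (cox_graph W S)\<^sup>*" using assms by (auto simp: cox_irreducible_def)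
  then have "s \<in> K"
  proof induction
    case (step y z)
    then have "y \<in> S" "z \<in> S" by (auto simp: cox_graph_def)
    then show ?case using step commuting_not_edge[of y z] assms(3)[of y z] by fastforce
  qed (use k in auto)
  then show False using s by auto
qed

end

section \<open>Panels, galleries and codistances\<close>

text \<open>Only reachability is recorded, not the sequence of chambers. This allows induction over
  single adjacencies in a residue, and symmetry and transitivity of residues follow from the
  closure.\<close>

definition gallery :: "'c set \<Rightarrow> ('c \<Rightarrow> 'c \<Rightarrow> 'w) \<Rightarrow> 'w set \<Rightarrow> 'c \<Rightarrow> 'c \<Rightarrow> bool" where
  "gallery Ch \<delta> K = (\<lambda>C D. C \<in> Ch \<and> D \<in> Ch \<and> \<delta> C D \<in> K)\<^sup>*\<^sup>*"

context building
begin

section \<open>Panels and residues in one building\<close>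

lemma dist_gen_sym:
  assumes "C \<in> Ch" "D \<in> Ch" "s \<in> S" "\<delta> C D = s"
  shows "\<delta> D C = s"
proof -
  have "C \<noteq> D" using assms WD1[of C D] gens_nontrivial by auto
  then have "\<delta> D C \<noteq> \<one>" using WD1[of D C] assms by auto
  moreover have "\<delta> C C = \<one>" using WD1[of C C] assms by simp
  ultimately have "s \<otimes> \<delta> D C = \<one>" using WD2[of D C C s] assms by auto
  then show ?thesis
    using assms dist_closed[of D C] by (metis gens_cancel gens_carrier r_one)
qed

lemma same_panel:
  assumes "C \<in> Ch" "D \<in> Ch" "E \<in> Ch" "s \<in> S" "\<delta> C D = s" "\<delta> C E = s"
  shows "D = E \<or> \<delta> D E = s"
  using WD2[of C E D s] dist_gen_sym[of C D s] WD1[of D E] assms by (auto simp: gens_involution)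

text \<open>With different types at C, \<open>WD2'\<close> would make \<delta> D E a product of two
  distinct generators, which has length two. This recovers panels from adjacency alone, without
  knowledge of types.\<close>

lemma adjacent_triangle:
  assumes "C \<in> Ch" "D \<in> Ch" "E \<in> Ch" "\<delta> C D \<in> S" "\<delta> C E \<in> S" "\<delta> D E \<in> S"
  shows "\<delta> C D = \<delta> C E"
proof (rule ccontr)
  assume neq: "\<delta> C D \<noteq> \<delta> C E"
  have "\<delta> D C = \<delta> C D" by (rule dist_gen_sym[OF assms(1,2,4) HOL.refl])
  then have "\<delta> D E = \<delta> C D \<otimes> \<delta> C E"
    using WD2'[of C E D "\<delta> C D"] len_two_gens[OF _ _ neq] assms by simp
  then show False using len_two_gens[OF _ _ neq] len_gen[of "\<delta> D E"] assms by simp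
qed

lemma obtain_neighbour:
  assumes "C \<in> Ch" "s \<in> S"
  obtains D where "D \<in> Ch" "\<delta> C D = s"
  using WD3[of C C s] dist_gen_sym assms by blast

text \<open>\<open>WD3\<close> realises a word for the distance letter by letter as a gallery;
  conversely, by \<open>WD2\<close> each step of a gallery multiplies the distance by an element of
  \<open>K\<close> or leaves it unchanged.\<close>

lemma dist_parabolic_iff_gallery:
  assumes K: "K \<subseteq> S" and C: "C \<in> Ch" and D: "D \<in> Ch"
  shows "\<delta> C D \<in> generate W K \<longleftrightarrow> gallery Ch \<delta> K C D"
proof
  assume "\<delta> C D \<in> generate W K"
  then obtain us where "set us \<subseteq> K" "word_prod W us = \<delta> C D" using generate_words[OF K] by blast
  then show "gallery Ch \<delta> K C D"
    using C
  proof (induction us arbitrary: C)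
    case Nil
    then show ?case using WD1[of C D] D by (auto simp: gallery_def)
  next
    case (Cons s us)
    have s: "s \<in> K" "s \<in> S" and us: "set us \<subseteq> S" using Cons.prems K by auto
    obtain E where E: "E \<in> Ch" "\<delta> E C = s" "\<delta> E D = s \<otimes> \<delta> C D"
      using WD3[of C D s] Cons.prems D s by auto
    then have "\<delta> E D = word_prod W us" using Cons.prems(2) s us
      by (metis gens_cancel word_prod_Cons word_prod_closed words_carrier)
    then have "gallery Ch \<delta> K E D" using Cons E by simp
    moreover have "\<delta> C E = s" by (rule dist_gen_sym[OF E(1) Cons.prems(3) s(2) E(2)])
    ultimately show ?case
      unfolding gallery_def using E Cons.prems s by (intro converse_rtranclp_into_rtranclp[of _ C E]) auto
  qed
next
  assume "gallery Ch \<delta> K C D"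
  then show "\<delta> C D \<in> generate W K"
    unfolding gallery_def
  proof (induction rule: converse_rtranclp_induct)
    case base
    then show ?case using WD1[of D D] D generate.one[of W K] by simp
  next
    case (step C E)
    then have "\<delta> C E \<in> S" using K by auto
    then have "\<delta> C D \<in> {\<delta> C E \<otimes> \<delta> E D, \<delta> E D}" using WD2[of E D C "\<delta> C E"] step D by auto
    moreover have "\<delta> C E \<otimes> \<delta> E D \<in> generate W K"
      using step generate.incl[of "\<delta> C E" K W] by (intro generate.eng) auto
    ultimately show ?case using step.IH by auto
  qed
qed

lemma dist_parabolic_trans:
  assumes "K \<subseteq> S" "C \<in> Ch" "D \<in> Ch" "E \<in> Ch"
    and "\<delta> C D \<in> generate W K" "\<delta> D E \<in> generate W K"
  shows "\<delta> C E \<in> generate W K"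
  using assms(5,6) rtranclp_trans
  unfolding dist_parabolic_iff_gallery[OF assms(1,2,3)] dist_parabolic_iff_gallery[OF assms(1,3,4)]
    dist_parabolic_iff_gallery[OF assms(1,2,4)] gallery_def by fastforce

lemma dist_parabolic_sym:
  assumes K: "K \<subseteq> S" and C: "C \<in> Ch" and D: "D \<in> Ch" and CD: "\<delta> C D \<in> generate W K"
  shows "\<delta> D C \<in> generate W K"
proof -
  let ?R = "\<lambda>C D. C \<in> Ch \<and> D \<in> Ch \<and> \<delta> C D \<in> K"
  have "symp ?R"
  proof (rule sympI)
    fix C D assume CD: "?R C D"
    then have "\<delta> C D \<in> S" using K by blast
    then have "\<delta> D C = \<delta> C D" using CD dist_gen_sym[of C D] by blast
    then show "?R D C" using CD by simp
  qed
  then have "symp ?R\<^sup>*\<^sup>*" by (rule symp_rtranclp)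
  then show ?thesis
    using assms by (auto simp: dist_parabolic_iff_gallery gallery_def dest: sympD)
qed

end

context twin_building
begin

section \<open>Codistances and their change along galleries\<close>

sublocale half: building W S "Ch \<epsilon>" \<delta> for \<epsilon>
  by (rule halves_building)

lemma half_unique: "C \<in> Ch \<epsilon> \<Longrightarrow> C \<in> Ch \<epsilon>' \<Longrightarrow> \<epsilon> = \<epsilon>'"
  using halves_disjoint by (cases \<epsilon>; cases \<epsilon>') auto

lemma chambers_iff: "C \<in> chambers Ch \<longleftrightarrow> (\<exists>\<epsilon>. C \<in> Ch \<epsilon>)"
  unfolding chambers_def by (metis (full_types) Un_iff)

lemma s_adjacent_iff: "C \<in> Ch \<epsilon> \<Longrightarrow> s_adjacent Ch \<delta> s C D \<longleftrightarrow> D \<in> Ch \<epsilon> \<and> \<delta> C D = s"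
  unfolding s_adjacent_def using half_unique by blast

lemma adjacent_iff: "C \<in> Ch \<epsilon> \<Longrightarrow> adjacent S Ch \<delta> C D \<longleftrightarrow> D \<in> Ch \<epsilon> \<and> \<delta> C D \<in> S"
  unfolding adjacent_def using s_adjacent_iff by auto

lemma opposite_iff: "C \<in> Ch \<epsilon> \<Longrightarrow> opposite W Ch \<delta>' C D \<longleftrightarrow> D \<in> Ch (\<not> \<epsilon>) \<and> \<delta>' C D = \<one>"
  unfolding opposite_def using half_unique by blast

text \<open>\<open>Tw2\<close> settles the case where s shortens w. If s lengthens w,
  \<open>Tw3\<close> gives one chamber F of the panel with codistance sw, and \<open>Tw2\<close>
  started at F returns every other chamber of the panel to w.\<close>

lemma codist_adjacent:
  assumes C: "C \<in> Ch \<epsilon>" and D: "D \<in> Ch (\<not> \<epsilon>)" and E: "E \<in> Ch (\<not> \<epsilon>)" and s: "s \<in> S" "\<delta> D E = s"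
  shows "\<delta>' C E = \<delta>' C D \<or> \<delta>' C E = s \<otimes> \<delta>' C D"
proof -
  let ?w = "\<delta>' C D"
  have w: "?w \<in> carrier W" using codist_closed C D by blast
  from len_gen_mult[OF s(1) w] show ?thesis
  proof
    assume up: "len (s \<otimes> ?w) = len ?w + 1"
    obtain F where F: "F \<in> Ch (\<not> \<epsilon>)" "\<delta> D F = s" "\<delta>' C F = s \<otimes> ?w"
      using Tw3[OF C D s(1)] by blast
    consider "F = E" | "\<delta> F E = s" using half.same_panel[of D "\<not> \<epsilon>" F E s] D E F s by auto
    then show ?thesis
    proof cases
      case 2
      then have "\<delta>' C E = s \<otimes> (s \<otimes> ?w)"
        using Tw2[OF C F(1) E s(1)] F up s w by simp
      then show ?thesis using s w by simp
    qed (use F in auto)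
  next
    assume "len (s \<otimes> ?w) + 1 = len ?w"
    then show ?thesis using Tw2[OF C D E s] by simp
  qed
qed

text \<open>The axioms move the second argument; \<open>Tw1\<close> turns their left multiplication
  into right multiplication when the first argument moves.\<close>

lemma obtain_codist_first:
  assumes C: "C \<in> Ch \<epsilon>" and D: "D \<in> Ch (\<not> \<epsilon>)" and s: "s \<in> S"
  obtains E where "E \<in> Ch \<epsilon>" "\<delta> C E = s" "\<delta>' E D = \<delta>' C D \<otimes> s"
proof -
  have C': "C \<in> Ch (\<not> \<not> \<epsilon>)" using C by simp
  obtain E where E: "E \<in> Ch \<epsilon>" "\<delta> C E = s" "\<delta>' D E = s \<otimes> \<delta>' D C"
    using Tw3[OF D C' s] by auto
  have w: "\<delta>' C D \<in> carrier W" using codist_closed C D by blast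
  have "\<delta>' E D = inv (\<delta>' D E)" using Tw1[of D "\<not> \<epsilon>" E] D E by simp
  then have "\<delta>' E D = \<delta>' C D \<otimes> s"
    using E Tw1[OF C D] w s by (simp add: inv_mult_group)
  then show thesis using that E by blast
qed

lemma codist_residue:
  assumes K: "K \<subseteq> S" and C: "C \<in> Ch \<epsilon>" and D: "D \<in> Ch (\<not> \<epsilon>)" and E: "E \<in> Ch (\<not> \<epsilon>)"
    and DE: "\<delta> D E \<in> generate W K"
  shows "\<exists>v\<in>generate W K. \<delta>' C E = v \<otimes> \<delta>' C D"
proof -
  have "gallery (Ch (\<not> \<epsilon>)) \<delta> K D E"
    using half.dist_parabolic_iff_gallery[OF K D E] DE by simp
  then show ?thesis
    unfolding gallery_def
  proof (induction rule: rtranclp_induct)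
    case base
    then show ?case using codist_closed[OF C D] generate.one[of W K] by force
  next
    case (step E F)
    then obtain v where v: "v \<in> generate W K" "\<delta>' C E = v \<otimes> \<delta>' C D" by blast
    let ?s = "\<delta> E F"
    have s: "?s \<in> S" "?s \<in> generate W K" using step K by (auto intro: generate.incl)
    from codist_adjacent[OF C, of E F ?s] step s
    consider "\<delta>' C F = \<delta>' C E" | "\<delta>' C F = ?s \<otimes> \<delta>' C E" by auto
    then show ?case
    proof cases
      case 2
      then have "\<delta>' C F = (?s \<otimes> v) \<otimes> \<delta>' C D"
        using v s codist_closed[OF C D] parabolic_carrier[OF K] by (simp add: m_assoc)
      then show ?thesis using s v generate.eng by metis
    qed (use v in auto)
  qed
qed


section \<open>Automorphisms and opposition\<close>

lemma automorphism_adjacent: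
  assumes "twin_automorphism W S Ch \<delta> \<delta>' \<theta>"
    and "C \<in> Ch \<epsilon>" "\<theta> C \<in> Ch \<epsilon>'" "D \<in> chambers Ch"
  shows "D \<in> Ch \<epsilon> \<and> \<delta> C D \<in> S \<longleftrightarrow> \<theta> D \<in> Ch \<epsilon>' \<and> \<delta> (\<theta> C) (\<theta> D) \<in> S"
proof -
  have "C \<in> chambers Ch" using assms chambers_iff by blast
  then have "adjacent S Ch \<delta> C D \<longleftrightarrow> adjacent S Ch \<delta> (\<theta> C) (\<theta> D)"
    using assms unfolding twin_automorphism_def by blast
  then show ?thesis using adjacent_iff assms by simp
qed

text \<open>For s in \<open>K\<close>, let D in the second residue be opposite C. An s-neighbour E
  of C has codistance s from D and is itself opposite some F in that residue. Moving from D to F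
  multiplies the codistance by an element of the subgroup generated by \<open>L\<close>, so s lies
  there.\<close>

lemma opposite_residue_type_subset:
  assumes K: "K \<subseteq> S" and L: "L \<subseteq> S" and C: "C \<in> Ch \<epsilon>" and C0: "C0 \<in> Ch (\<not> \<epsilon>)"
    and opp: "\<And>E. E \<in> Ch \<epsilon> \<Longrightarrow> \<delta> C E \<in> generate W K \<Longrightarrow>
      \<exists>D\<in>Ch (\<not> \<epsilon>). \<delta> C0 D \<in> generate W L \<and> \<delta>' E D = \<one>"
  shows "K \<subseteq> L"
proof
  fix s assume sK: "s \<in> K"
  then have s: "s \<in> S" using K by auto
  have "\<delta> C C = \<one>" using half.WD1 C by blast
  then have "\<delta> C C \<in> generate W K" using generate.one[of W K] by simp
  then obtain D where D: "D \<in> Ch (\<not> \<epsilon>)" "\<delta> C0 D \<in> generate W L" "\<delta>' C D = \<one>"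
    using opp C by blast
  obtain E where E: "E \<in> Ch \<epsilon>" "\<delta> C E = s" "\<delta>' E D = \<delta>' C D \<otimes> s"
    using obtain_codist_first[OF C D(1) s] .
  then obtain F where F: "F \<in> Ch (\<not> \<epsilon>)" "\<delta> C0 F \<in> generate W L" "\<delta>' E F = \<one>"
    using opp[of E] sK generate.incl[of s K W] by auto
  have "\<delta> D F \<in> generate W L"
    using half.dist_parabolic_sym[OF L C0 D(1,2)] half.dist_parabolic_trans[OF L D(1) C0 F(1)] F(2)
    by blast
  then obtain v where v: "v \<in> generate W L" "\<delta>' E F = v \<otimes> \<delta>' E D"
    using codist_residue[OF L E(1) D(1) F(1)] by blast
  then have "v \<otimes> s = \<one>" using E D F s by simp
  then have "s \<in> generate W L"
    using generate_cancel_left[OF L v(1), of s] generate.one[of W L] s by simp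
  then show "s \<in> L" using gen_in_parabolic L s by blast
qed

text \<open>Each type t in \<open>L\<close> is realised by a neighbour of \<theta> C; the type of
  its preimage at C lies in \<open>K\<close>. Assigning this type to t is injective, although
  \<theta> need not act on types through one permutation.\<close>

lemma image_residue_type_card:
  assumes aut: "twin_automorphism W S Ch \<delta> \<delta>' \<theta>" and fin: "finite S"
    and K: "K \<subseteq> S" and L: "L \<subseteq> S" and C: "C \<in> Ch \<epsilon>" and \<theta>C: "\<theta> C \<in> Ch \<epsilon>'"
    and img: "\<And>F. F \<in> Ch \<epsilon>' \<Longrightarrow> \<delta> (\<theta> C) F \<in> generate W L \<Longrightarrow>
      \<exists>D\<in>Ch \<epsilon>. \<delta> C D \<in> generate W K \<and> F = \<theta> D"
  shows "card L \<le> card K"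
proof -
  have "\<exists>D\<in>Ch \<epsilon>. \<delta> C D \<in> K \<and> \<theta> D \<in> Ch \<epsilon>' \<and> \<delta> (\<theta> C) (\<theta> D) = t" if t: "t \<in> L" for t
  proof -
    have tS: "t \<in> S" using t L by auto
    obtain F where F: "F \<in> Ch \<epsilon>'" "\<delta> (\<theta> C) F = t"
      using half.obtain_neighbour[OF \<theta>C tS] .
    then obtain D where D: "D \<in> Ch \<epsilon>" "\<delta> C D \<in> generate W K" "F = \<theta> D"
      using img[of F] t generate.incl[of t L W] by auto
    then have "\<delta> C D \<in> S"
      using automorphism_adjacent[OF aut C \<theta>C, of D] chambers_iff F tS by blast
    then have "\<delta> C D \<in> K" using gen_in_parabolic[OF K] D by blast
    then show ?thesis using D F by blast
  qed
  then obtain f where f: "\<And>t. t \<in> L \<Longrightarrow> f t \<in> Ch \<epsilon> \<and> \<delta> C (f t) \<in> K \<and> \<theta> (f t) \<in> Ch \<epsilon>' \<and>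
      \<delta> (\<theta> C) (\<theta> (f t)) = t"
    by metis
  \<comment> \<open>Two preimages in one panel of C are equal or adjacent. In the latter case
    \<theta> C and their images are mutually adjacent, so \<open>adjacent_triangle\<close> gives
    equal types.\<close>
  have "inj_on (\<lambda>t. \<delta> C (f t)) L"
  proof (rule inj_onI)
    fix t u assume t: "t \<in> L" and u: "u \<in> L" and eq: "\<delta> C (f t) = \<delta> C (f u)"
    have S: "\<delta> C (f t) \<in> S" "t \<in> S" "u \<in> S" using f[OF t] t u K L by auto
    from half.same_panel[of C \<epsilon> "f t" "f u"] consider "f t = f u" | "\<delta> (f t) (f u) \<in> S"
      using f[OF t] f[OF u] C eq S by metis
    then show "t = u"
    proof cases
      case 1
      then show ?thesis using f[OF t] f[OF u] by metis
    next
      case 2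
      then have "\<delta> (\<theta> (f t)) (\<theta> (f u)) \<in> S"
        using automorphism_adjacent[OF aut, of "f t" \<epsilon> \<epsilon>' "f u"] f[OF t] f[OF u] chambers_iff by blast
      then show ?thesis
        using half.adjacent_triangle[of "\<theta> C" \<epsilon>' "\<theta> (f t)" "\<theta> (f u)"] f[OF t] f[OF u] \<theta>C S by simp
    qed
  qed
  moreover have "(\<lambda>t. \<delta> C (f t)) ` L \<subseteq> K" using f by auto
  ultimately show ?thesis using card_inj_on_le finite_subset[OF K fin] by blast
qed

text \<open>Opposition of residues yields only some type \<open>L\<close> for the image. The two
  preceding lemmas give \<open>K = L\<close>, and then \<theta> C shares a \<open>K\<close>-residue
  with a chamber opposite C.\<close>

lemma codist_image_in_parabolic:
  assumes aut: "twin_automorphism W S Ch \<delta> \<delta>' \<theta>" and fin: "finite S" and K: "K \<subseteq> S"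
    and opp: "maps_residues_to_opposites W S Ch \<delta> \<delta>' \<theta> K" and C: "C \<in> Ch \<epsilon>"
  shows "\<theta> C \<in> Ch (\<not> \<epsilon>) \<and> \<delta>' C (\<theta> C) \<in> generate W K"
proof -
  let ?R = "{D \<in> Ch \<epsilon>. \<delta> C D \<in> generate W K}"
  have "\<delta> C C = \<one>" using half.WD1 C by blast
  then have CR: "C \<in> ?R" using C generate.one[of W K] by simp
  have "residue_of W Ch \<delta> K \<epsilon> ?R" unfolding residue_of_def using C by blast
  then have "opposite_residues W S Ch \<delta> \<delta>' ?R (\<theta> ` ?R)"
    using opp unfolding maps_residues_to_opposites_def by blast
  then obtain \<epsilon>' K' L where \<epsilon>': "residue_of W Ch \<delta> K' \<epsilon>' ?R"
    and L: "L \<subseteq> S" "residue_of W Ch \<delta> L (\<not> \<epsilon>') (\<theta> ` ?R)"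
    and opp': "\<And>E. E \<in> ?R \<Longrightarrow> \<exists>D\<in>\<theta> ` ?R. opposite W Ch \<delta>' E D"
    unfolding opposite_residues_def by blast
  have "C \<in> Ch \<epsilon>'" using \<epsilon>' CR unfolding residue_of_def by blast
  then have "\<epsilon>' = \<epsilon>" using half_unique C by blast
  then obtain C0 where C0: "C0 \<in> Ch (\<not> \<epsilon>)"
    and img: "\<theta> ` ?R = {D \<in> Ch (\<not> \<epsilon>). \<delta> C0 D \<in> generate W L}"
    using L unfolding residue_of_def by blast
  have \<theta>C: "\<theta> C \<in> Ch (\<not> \<epsilon>)" "\<delta> C0 (\<theta> C) \<in> generate W L" using CR img by blast+
  have opp'': "\<exists>D\<in>Ch (\<not> \<epsilon>). \<delta> C0 D \<in> generate W L \<and> \<delta>' E D = \<one>"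
    if "E \<in> Ch \<epsilon>" "\<delta> C E \<in> generate W K" for E
    using opp'[of E] opposite_iff[of E \<epsilon>] that img by blast
  have "K \<subseteq> L" using opposite_residue_type_subset[OF K L(1) C C0 opp''] by blast
  moreover have "card L \<le> card K"
  proof (rule image_residue_type_card[OF aut fin K L(1) C \<theta>C(1)])
    fix F assume "F \<in> Ch (\<not> \<epsilon>)" "\<delta> (\<theta> C) F \<in> generate W L"
    then have "F \<in> \<theta> ` ?R"
      using img half.dist_parabolic_trans[OF L(1) C0 \<theta>C(1)] \<theta>C(2) by blast
    then show "\<exists>D\<in>Ch \<epsilon>. \<delta> C D \<in> generate W K \<and> F = \<theta> D" by blast
  qed
  \<comment> \<open>Finiteness of S turns the inclusion of \<open>K\<close> in \<open>L\<close> and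
    the bound on cardinalities into equality.\<close>
  ultimately have KL: "K = L" using card_seteq finite_subset[OF L(1) fin] by metis
  obtain D where D: "D \<in> Ch (\<not> \<epsilon>)" "\<delta> C0 D \<in> generate W L" "\<delta>' C D = \<one>"
    using opp''[of C] CR by blast
  have "\<delta> D (\<theta> C) \<in> generate W L"
    using half.dist_parabolic_sym[OF L(1) C0 D(1,2)]
      half.dist_parabolic_trans[OF L(1) D(1) C0 \<theta>C(1)] \<theta>C(2) by blast
  then obtain v where v: "v \<in> generate W L" "\<delta>' C (\<theta> C) = v \<otimes> \<delta>' C D"
    using codist_residue[OF L(1) C D(1) \<theta>C(1)] by blast
  then have "\<delta>' C (\<theta> C) = v" using D parabolic_carrier[OF L(1)] by simp
  then show ?thesis using v KL \<theta>C by simp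
qed

text \<open>The hypothesis \<open>cod\<close> speaks of all chambers because it is used both at C
  and at a neighbour D of C.\<close>

lemma codist_image_commutes:
  assumes aut: "twin_automorphism W S Ch \<delta> \<delta>' \<theta>" and K: "K \<subseteq> S" and s: "s \<in> S - K"
    and cod: "\<And>\<epsilon> C. C \<in> Ch \<epsilon> \<Longrightarrow> \<theta> C \<in> Ch (\<not> \<epsilon>) \<and> \<delta>' C (\<theta> C) \<in> generate W K"
    and C: "C \<in> Ch \<epsilon>"
  shows "\<delta>' C (\<theta> C) \<in> generate W {k \<in> K. s \<otimes> k = k \<otimes> s}"
proof -
  let ?w = "\<delta>' C (\<theta> C)"
  have sS: "s \<in> S" and w: "?w \<in> generate W K" and wc: "?w \<in> carrier W" and \<theta>C: "\<theta> C \<in> Ch (\<not> \<epsilon>)"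
    using s cod[OF C] parabolic_carrier[OF K] by auto
  obtain D where D: "D \<in> Ch \<epsilon>" "\<delta> C D = s" "\<delta>' D (\<theta> C) = ?w \<otimes> s"
    using obtain_codist_first[OF C \<theta>C sS] .
  let ?t = "\<delta> (\<theta> C) (\<theta> D)"
  have t: "\<theta> D \<in> Ch (\<not> \<epsilon>)" "?t \<in> S"
    using automorphism_adjacent[OF aut C \<theta>C, of D] D sS chambers_iff by auto
  have D': "\<delta>' D (\<theta> D) \<in> generate W K" using cod[OF D(1)] by blast
  have s_notin: "s \<notin> generate W K" using gen_in_parabolic[OF K sS] s by blast
  \<comment> \<open>This excludes that the codistance from D stays the same on passing from \<theta>
    C to \<theta> D, so the factor \<open>?t\<close> must appear.\<close>
  then have "?w \<otimes> s \<notin> generate W K" using generate_cancel_left[OF K w] sS by auto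
  then have "\<delta>' D (\<theta> D) = ?t \<otimes> (?w \<otimes> s)"
    using codist_adjacent[OF D(1) \<theta>C t(1) t(2)] D D' by auto
  then have tws: "?t \<otimes> (?w \<otimes> s) \<in> generate W K" using D' by simp
  \<comment> \<open>Otherwise t and w could be cancelled from tws within the subgroup generated by
    \<open>K\<close> and t, which would then contain s.\<close>
  have "?t = s"
  proof (rule ccontr)
    assume neq: "?t \<noteq> s"
    let ?L = "insert ?t K"
    have L: "?L \<subseteq> S" using K t by auto
    have KL: "generate W K \<subseteq> generate W ?L" by (rule mono_generate) auto
    then have "?w \<otimes> s \<in> generate W ?L"
      using generate_cancel_left[OF L _ _, of ?t "?w \<otimes> s"] tws wc sS generate.incl[of ?t ?L W] by auto
    then have "s \<in> generate W ?L"
      using generate_cancel_left[OF L _ _, of ?w s] w KL sS by auto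
    then show False using gen_in_parabolic[OF L sS] neq s by blast
  qed
  then have "s \<otimes> ?w \<otimes> s \<in> generate W K" using tws sS wc by (simp add: m_assoc)
  then show ?thesis using parabolic_conj_gen[OF K s w] by blast
qed

lemma residues_to_chambers_opposite:
  assumes aut: "twin_automorphism W S Ch \<delta> \<delta>' \<theta>" and fin: "finite S"
    and irr: "cox_irreducible W S" and K: "K \<subset> S"
    and opp: "maps_residues_to_opposites W S Ch \<delta> \<delta>' \<theta> K"
  shows "maps_chambers_to_opposites W Ch \<delta>' \<theta>"
proof -
  define P where "P L \<longleftrightarrow> L \<subset> S \<and>
    (\<forall>\<epsilon>. \<forall>C\<in>Ch \<epsilon>. \<theta> C \<in> Ch (\<not> \<epsilon>) \<and> \<delta>' C (\<theta> C) \<in> generate W L)" for L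
  have "P K" using codist_image_in_parabolic[OF aut fin _ opp] K by (auto simp: P_def)
  then obtain L where L: "P L" and min: "\<And>L'. P L' \<Longrightarrow> card L \<le> card L'"
    using ex_has_least_nat[of P K card] by blast
  have LS: "L \<subset> S" "L \<subseteq> S" and
    cod: "\<And>\<epsilon> C. C \<in> Ch \<epsilon> \<Longrightarrow> \<theta> C \<in> Ch (\<not> \<epsilon>) \<and> \<delta>' C (\<theta> C) \<in> generate W L"
    using L by (auto simp: P_def)
  have "s \<otimes> k = k \<otimes> s" if k: "k \<in> L" and s: "s \<in> S - L" for k s
  proof -
    let ?L = "{k \<in> L. s \<otimes> k = k \<otimes> s}"
    have "P ?L"
      unfolding P_def using codist_image_commutes[OF aut LS(2) s cod] cod LS(1) by blast
    \<comment> \<open>The set \<open>?L\<close> also satisfies \<open>P\<close>, so minimality of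
      the cardinality makes every s outside \<open>L\<close> commute with all of
      \<open>L\<close>.\<close>
    then have "?L = L"
      using min[of ?L] card_seteq[of L ?L] finite_subset[OF LS(2) fin] by blast
    then show ?thesis using k by blast
  qed
  then have "L = {}" using irreducible_no_commuting_split[OF irr LS(1)] by blast
  then have "\<theta> C \<in> Ch (\<not> \<epsilon>) \<and> \<delta>' C (\<theta> C) = \<one>" if "C \<in> Ch \<epsilon>" for C \<epsilon>
    using cod[OF that] generate_empty by blast
  then show ?thesis
    unfolding maps_chambers_to_opposites_def using chambers_iff opposite_iff by blast
qed

section \<open>Automorphisms mapping every chamber to an opposite one\<close>

context
  fixes \<theta>
  assumes aut: "twin_automorphism W S Ch \<delta> \<delta>' \<theta>" and opp: "maps_chambers_to_opposites W Ch \<delta>' \<theta>"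
begin

lemma image_opposite:
  assumes "C \<in> Ch \<epsilon>"
  shows "\<theta> C \<in> Ch (\<not> \<epsilon>)" "\<delta>' C (\<theta> C) = \<one>"
  using opp assms opposite_iff chambers_iff unfolding maps_chambers_to_opposites_def by blast+

text \<open>The type is first determined for one chamber E of the panel, chosen so that its
  codistance from \<theta> C is the generator s; \<open>adjacent_triangle\<close> then transfers it
  to the whole panel.\<close>

lemma opposite_preserves_adjacency_type:
  assumes C: "C \<in> Ch \<epsilon>" and D: "D \<in> Ch \<epsilon>" and s: "\<delta> C D \<in> S"
  shows "\<delta> (\<theta> C) (\<theta> D) = \<delta> C D"
proof -
  let ?s = "\<delta> C D"
  note \<theta>C = image_opposite[OF C] and \<theta>D = image_opposite[OF D]
  have adj: "\<delta> (\<theta> A) (\<theta> B) \<in> S" if "A \<in> Ch \<epsilon>" "B \<in> Ch \<epsilon>" "\<delta> A B \<in> S" for A B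
    using automorphism_adjacent[OF aut that(1) image_opposite(1)[OF that(1)], of B] that chambers_iff
    by blast
  obtain E where E: "E \<in> Ch \<epsilon>" "\<delta> C E = ?s" "\<delta>' E (\<theta> C) = \<delta>' C (\<theta> C) \<otimes> ?s"
    using obtain_codist_first[OF C \<theta>C(1) s] .
  note \<theta>E = image_opposite[OF E(1)]
  let ?t = "\<delta> (\<theta> C) (\<theta> E)"
  have t: "?t \<in> S" using adj[OF C E(1)] E s by simp
  have "\<delta>' E (\<theta> C) = ?s" using E \<theta>C s by simp
  \<comment> \<open>E is opposite \<theta> E, so the step from \<theta> C to \<theta> E must turn
    the codistance s into 1, which forces its type to be s.\<close>
  then have "\<one> = ?s \<or> \<one> = ?t \<otimes> ?s"
    using codist_adjacent[OF E(1) \<theta>C(1) \<theta>E(1) t] \<theta>E by simp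
  then have ts: "?t = ?s"
    using gens_nontrivial[OF s] s t by (metis gens_carrier gens_inv inv_equality)
  consider "D = E" | "\<delta> D E = ?s" using half.same_panel[OF C D E(1) s HOL.refl E(2)] by blast
  then show ?thesis
  proof cases
    case 2
    then have "\<delta> D E \<in> S" using s by metis
    then have "\<delta> (\<theta> D) (\<theta> E) \<in> S" by (rule adj[OF D E(1)])
    then have "\<delta> (\<theta> C) (\<theta> D) = ?t"
      by (rule half.adjacent_triangle[OF \<theta>C(1) \<theta>D(1) \<theta>E(1) adj[OF C D s] t])
    then show ?thesis using ts by (rule HOL.trans)
  qed (use ts in simp)
qed

lemma opposite_type_preserving: "type_preserving W S Ch \<delta> \<theta>"
  unfolding type_preserving_def induces_type_map_def
proof (intro conjI ballI allI impI)
  fix s C D assume s: "s \<in> S" and "s_adjacent Ch \<delta> s C D"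
  then obtain \<epsilon> where *: "C \<in> Ch \<epsilon>" "D \<in> Ch \<epsilon>" "\<delta> C D = s" unfolding s_adjacent_def by blast
  then show "s_adjacent Ch \<delta> (id s) (\<theta> C) (\<theta> D)"
    unfolding s_adjacent_def
    using image_opposite(1) opposite_preserves_adjacency_type[of C \<epsilon> D] s by auto
qed simp_all

text \<open>Galleries with types in \<open>K\<close> map to galleries of the same types, and each
  gallery from \<theta> C lifts step by step to one from C.\<close>

lemma image_residue:
  assumes K: "K \<subseteq> S" and C: "C \<in> Ch \<epsilon>"
  shows "\<theta> ` {D \<in> Ch \<epsilon>. \<delta> C D \<in> generate W K} = {D \<in> Ch (\<not> \<epsilon>). \<delta> (\<theta> C) D \<in> generate W K}"
proof -
  note \<theta>C = image_opposite(1)[OF C]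
  have "gallery (Ch (\<not> \<epsilon>)) \<delta> K (\<theta> C) (\<theta> D)" if "gallery (Ch \<epsilon>) \<delta> K C D" for D
    using that unfolding gallery_def
  proof (induction rule: rtranclp_induct)
    case (step D E)
    then have "\<delta> (\<theta> D) (\<theta> E) = \<delta> D E" using opposite_preserves_adjacency_type[of D \<epsilon> E] K by auto
    then show ?case
      using step image_opposite(1) by (intro rtranclp.rtrancl_into_rtrancl[OF step.IH]) auto
  qed simp
  moreover have "\<exists>D\<in>Ch \<epsilon>. gallery (Ch \<epsilon>) \<delta> K C D \<and> F = \<theta> D"
    if "gallery (Ch (\<not> \<epsilon>)) \<delta> K (\<theta> C) F" for F
    using that unfolding gallery_def
  proof (induction rule: rtranclp_induct)
    case base
    show ?case using C by auto
  next
    case (step F E)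
    then obtain D where D: "D \<in> Ch \<epsilon>" "(\<lambda>C D. C \<in> Ch \<epsilon> \<and> D \<in> Ch \<epsilon> \<and> \<delta> C D \<in> K)\<^sup>*\<^sup>* C D" "F = \<theta> D"
      by blast
    \<comment> \<open>Surjectivity concerns both halves together; adjacency to D then places the
      preimage of E in the half of D.\<close>
    have "\<theta> ` chambers Ch = chambers Ch"
      using aut unfolding twin_automorphism_def by (simp add: bij_betw_def)
    moreover have "E \<in> chambers Ch" using step chambers_iff by blast
    ultimately obtain E' where E': "E' \<in> chambers Ch" "E = \<theta> E'" by blast
    then have *: "E' \<in> Ch \<epsilon>" "\<delta> D E' \<in> S"
      using automorphism_adjacent[OF aut D(1) image_opposite(1)[OF D(1)] E'(1)] step D K by auto
    then have "\<delta> D E' \<in> K" using opposite_preserves_adjacency_type[OF D(1) *] step D E' by simp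
    then have "(\<lambda>C D. C \<in> Ch \<epsilon> \<and> D \<in> Ch \<epsilon> \<and> \<delta> C D \<in> K)\<^sup>*\<^sup>* C E'"
      using D * by (intro rtranclp.rtrancl_into_rtrancl[OF D(2)]) auto
    then show ?case using * E' by blast
  qed
  ultimately show ?thesis
    using half.dist_parabolic_iff_gallery[OF K C] half.dist_parabolic_iff_gallery[OF K \<theta>C]
      image_opposite(1) by blast
qed

lemma opposite_maps_residues_to_opposites:
  assumes K: "K \<subseteq> S"
  shows "maps_residues_to_opposites W S Ch \<delta> \<delta>' \<theta> K"
  unfolding maps_residues_to_opposites_def
proof (intro allI impI)
  fix \<epsilon> R assume R: "residue_of W Ch \<delta> K \<epsilon> R"
  then obtain C where C: "C \<in> Ch \<epsilon>" "R = {D \<in> Ch \<epsilon>. \<delta> C D \<in> generate W K}"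
    unfolding residue_of_def by blast
  have "residue_of W Ch \<delta> K (\<not> \<epsilon>) (\<theta> ` R)"
    unfolding residue_of_def C(2) using image_residue[OF K C(1)] image_opposite(1)[OF C(1)] by blast
  moreover have "\<forall>D\<in>R. \<exists>E\<in>\<theta> ` R. opposite W Ch \<delta>' D E"
    using C image_opposite opposite_iff by blast
  ultimately show "opposite_residues W S Ch \<delta> \<delta>' R (\<theta> ` R)"
    unfolding opposite_residues_def using R K by blast
qed

end

end

theorem theorem1p3:
  fixes W :: "('w, 'm) monoid_scheme" and S J :: "'w set"
    and Ch :: "bool \<Rightarrow> 'c set" and \<delta> \<delta>' :: "'c \<Rightarrow> 'c \<Rightarrow> 'w" and \<theta> :: "'c \<Rightarrow> 'c"
  assumes "coxeter_system W S" and "finite S" and "cox_irreducible W S"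
    and "twin_building W S Ch \<delta> \<delta>'"
    and "J \<subseteq> S" and "J \<noteq> {}"
    and "twin_automorphism W S Ch \<delta> \<delta>' \<theta>"
  shows "(maps_residues_to_opposites W S Ch \<delta> \<delta>' \<theta> (S - J) \<longleftrightarrow>
            maps_chambers_to_opposites W Ch \<delta>' \<theta>) \<and>
         (maps_chambers_to_opposites W Ch \<delta>' \<theta> \<longrightarrow>
            type_preserving W S Ch \<delta> \<theta> \<and>
            (\<forall>K\<subseteq>S. maps_residues_to_opposites W S Ch \<delta> \<delta>' \<theta> K))"
proof -
  interpret twin_building W S Ch \<delta> \<delta>' by fact
  \<comment> \<open>Since J is nonempty, some generator lies outside S - J; properness is what
    starts the reduction to the empty type.\<close>
  have "S - J \<subset> S" using assms by blast
  then show ?thesis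
    using residues_to_chambers_opposite[OF assms(7,2,3)] opposite_type_preserving[OF assms(7)]
      opposite_maps_residues_to_opposites[OF assms(7)] by blast
qed

end
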